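(* Every $\Sigma$-formula $\phi$ is $\mathfrak{D}$-equivalent to an $\mathcal{L}_{BT}$-formula of the form $(Q_1^{t_1}v_1)\cdots(Q_m^{t_m}v_m)\,s=t$, where $s,t,t_1,\ldots,t_m$ are $\mathcal{L}_{BT}$-terms and each $Q_j^{t_j}v_j$ is one of $\exists v_j$, $(\exists v_j\preceq t_j)$, $(\forall v_j\preceq t_j)$ for $j=1,\ldots,m$. Moreover, if $\phi$ is purely existential, then every $Q_j^{t_j}v_j$ is $\exists v_j$ (i.e. $\phi$ is $\mathfrak{D}$-equivalent to a formula of the form $\exists v_1\ldots v_m[s=t]$).
   Context: Bit strings are elements of $\{\mathbf{0},\mathbf{1}\}^*$; $\varepsilon$ is the empty string. The language $\mathcal{L}_{BT}$ has constant symbols $e,0,1$, binary function symbol $\circ$, and binary relation symbol $\preceq$. The structure $\mathfrak{D}$ has universe $\{\mathbf{0},\mathbf{1}\}^*$, interprets $e,0,1$ as $\varepsilon,\mathbf{0},\mathbf{1}$, $\circ$ as concatenation, and $\preceq$ as the prefix relation. $(\exists x\preceq t)\phi$ abbreviates $\exists x[x\preceq t\wedge\phi]$, $(\forall x\preceq t)\phi$ abbreviates $\forall x[x\preceq t\to\phi]$. $\Sigma$-formulas: $s\preceq t$, $\neg s\preceq t$, $s=t$, $\neg s=t$ (terms $s,t$) are $\Sigma$-formulas; they are closed under $\wedge,\vee$, and under $(\exists x\preceq t)$, $(\forall x\preceq t)$ and $\exists x$ where $x$ does not occur in $t$. A purely existential formula is a $\Sigma$-formula with no bounded universal quantifiers.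 Two formulas are $\mathfrak{D}$-equivalent if their biconditional (universally closed) holds in $\mathfrak{D}$. *)

theory Defs
  imports "HOL-Library.Sublist"
begin

text \<open>Bit strings are lists of Booleans; \<^const>\<open>False\<close> is the bit 0 and \<^const>\<open>True\<close> is the bit 1.\<close>

type_synonym bitstring = "bool list"

datatype bt_term =
    Var nat
  | Const_e
  | Const_0
  | Const_1
  | Conc bt_term bt_term  (infixr "\<odot>" 75)

datatype bt_formula =
    Eq bt_term bt_term  (infix "\<doteq>" 60)
  | Pre bt_term bt_term  (infix "\<preceq>\<^sub>B" 60)
  | Neg bt_formula
  | And bt_formula bt_formula
  | Or bt_formula bt_formula
  | Imp bt_formula bt_formula
  | Ex nat bt_formula
  | All nat bt_formula

fun tvars :: "bt_term \<Rightarrow> nat set" where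
  "tvars (Var x) = {x}"
| "tvars Const_e = {}"
| "tvars Const_0 = {}"
| "tvars Const_1 = {}"
| "tvars (s \<odot> t) = tvars s \<union> tvars t"

abbreviation BEx :: "nat \<Rightarrow> bt_term \<Rightarrow> bt_formula \<Rightarrow> bt_formula" where
  "BEx x t \<phi> \<equiv> Ex x (And (Var x \<preceq>\<^sub>B t) \<phi>)"

abbreviation BAll :: "nat \<Rightarrow> bt_term \<Rightarrow> bt_formula \<Rightarrow> bt_formula" where
  "BAll x t \<phi> \<equiv> All x (Imp (Var x \<preceq>\<^sub>B t) \<phi>)"

text \<open>Evaluation of terms and satisfaction of formulas in the structure of bit strings.\<close>

fun teval :: "(nat \<Rightarrow> bitstring) \<Rightarrow> bt_term \<Rightarrow> bitstring" where
  "teval \<sigma> (Var x) = \<sigma> x"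
| "teval \<sigma> Const_e = []"
| "teval \<sigma> Const_0 = [False]"
| "teval \<sigma> Const_1 = [True]"
| "teval \<sigma> (s \<odot> t) = teval \<sigma> s @ teval \<sigma> t"

fun sat :: "(nat \<Rightarrow> bitstring) \<Rightarrow> bt_formula \<Rightarrow> bool" where
  "sat \<sigma> (s \<doteq> t) \<longleftrightarrow> teval \<sigma> s = teval \<sigma> t"
| "sat \<sigma> (s \<preceq>\<^sub>B t) \<longleftrightarrow> prefix (teval \<sigma> s) (teval \<sigma> t)"
| "sat \<sigma> (Neg \<phi>) \<longleftrightarrow> \<not> sat \<sigma> \<phi>"
| "sat \<sigma> (And \<phi> \<psi>) \<longleftrightarrow> sat \<sigma> \<phi> \<and> sat \<sigma> \<psi>"
| "sat \<sigma> (Or \<phi> \<psi>) \<longleftrightarrow> sat \<sigma> \<phi> \<or> sat \<sigma> \<psi>"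
| "sat \<sigma> (Imp \<phi> \<psi>) \<longleftrightarrow> (sat \<sigma> \<phi> \<longrightarrow> sat \<sigma> \<psi>)"
| "sat \<sigma> (Ex x \<phi>) \<longleftrightarrow> (\<exists>a. sat (\<sigma>(x := a)) \<phi>)"
| "sat \<sigma> (All x \<phi>) \<longleftrightarrow> (\<forall>a. sat (\<sigma>(x := a)) \<phi>)"

text \<open>Quantifying over all assignments amounts to taking the universal closure of the biconditional.\<close>

definition D_equivalent :: "bt_formula \<Rightarrow> bt_formula \<Rightarrow> bool" where
  "D_equivalent \<phi> \<psi> \<longleftrightarrow> (\<forall>\<sigma>. sat \<sigma> \<phi> \<longleftrightarrow> sat \<sigma> \<psi>)"

inductive Sigma_formula :: "bt_formula \<Rightarrow> bool" where
  "Sigma_formula (s \<preceq>\<^sub>B t)"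
| "Sigma_formula (Neg (s \<preceq>\<^sub>B t))"
| "Sigma_formula (s \<doteq> t)"
| "Sigma_formula (Neg (s \<doteq> t))"
| "Sigma_formula \<phi> \<Longrightarrow> Sigma_formula \<psi> \<Longrightarrow> Sigma_formula (And \<phi> \<psi>)"
| "Sigma_formula \<phi> \<Longrightarrow> Sigma_formula \<psi> \<Longrightarrow> Sigma_formula (Or \<phi> \<psi>)"
| "Sigma_formula \<phi> \<Longrightarrow> x \<notin> tvars t \<Longrightarrow> Sigma_formula (BEx x t \<phi>)"
| "Sigma_formula \<phi> \<Longrightarrow> x \<notin> tvars t \<Longrightarrow> Sigma_formula (BAll x t \<phi>)"
| "Sigma_formula \<phi> \<Longrightarrow> Sigma_formula (Ex x \<phi>)"

fun All_free :: "bt_formula \<Rightarrow> bool" where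
  "All_free (s \<doteq> t) \<longleftrightarrow> True"
| "All_free (s \<preceq>\<^sub>B t) \<longleftrightarrow> True"
| "All_free (Neg \<phi>) \<longleftrightarrow> All_free \<phi>"
| "All_free (And \<phi> \<psi>) \<longleftrightarrow> All_free \<phi> \<and> All_free \<psi>"
| "All_free (Or \<phi> \<psi>) \<longleftrightarrow> All_free \<phi> \<and> All_free \<psi>"
| "All_free (Imp \<phi> \<psi>) \<longleftrightarrow> All_free \<phi> \<and> All_free \<psi>"
| "All_free (Ex x \<phi>) \<longleftrightarrow> All_free \<phi>"
| "All_free (All x \<phi>) \<longleftrightarrow> False"

text \<open>In a \<open>\<Sigma>\<close>-formula universal quantifiers occur only as part of the abbreviation
  \<^const>\<open>BAll\<close>, so having no bounded universal quantifier means containing no \<^const>\<open>All\<close>.\<close>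

definition purely_existential :: "bt_formula \<Rightarrow> bool" where
  "purely_existential \<phi> \<longleftrightarrow> Sigma_formula \<phi> \<and> All_free \<phi>"

datatype quantifier =
    QEx nat
  | QBEx nat bt_term
  | QBAll nat bt_term

fun quantify :: "quantifier \<Rightarrow> bt_formula \<Rightarrow> bt_formula" where
  "quantify (QEx v) \<phi> = Ex v \<phi>"
| "quantify (QBEx v t) \<phi> = BEx v t \<phi>"
| "quantify (QBAll v t) \<phi> = BAll v t \<phi>"

text \<open>The bound of a bounded quantifier must not mention the quantified variable, as in
  \<open>\<Sigma>\<close>-formulas; otherwise \<open>BAll v (Var v)\<close> would be an unbounded universal quantifier.\<close>

fun admissible :: "quantifier \<Rightarrow> bool" where
  "admissible (QEx v) \<longleftrightarrow> True"
| "admissible (QBEx v t) \<longleftrightarrow> v \<notin> tvars t"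
| "admissible (QBAll v t) \<longleftrightarrow> v \<notin> tvars t"

end

theory Submission
  imports Defs
begin

text \<open>
  Since bound variables can be renamed, quantifiers can be pulled to the front once conjunctions and
  disjunctions of equations are available. The conjunction of \<open>s = t\<close> and \<open>s' = t'\<close> is
  \<open>s0s's1s' = t0t't1t'\<close>. For the disjunction, \<open>xy = yx = 01\<close> forces \<open>{x, y} = {\<epsilon>, 01}\<close>, so the pair
  \<open>x, y\<close> makes a binary choice. The choice is enforced by writing \<open>s = pq\<close>, \<open>t = pr\<close> and demanding that
  \<open>qr\<close> commutes with \<open>x\<close> and with the word \<open>x'\<close> given by \<open>x0 = 0x'\<close>: for \<open>x = \<epsilon>\<close> this is no restriction,
  whereas for \<open>x = 01\<close> we have \<open>x' = 10\<close>, so a nonempty \<open>qr\<close> would begin with both \<open>0\<close> and \<open>1\<close>;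
  hence \<open>qr = \<epsilon>\<close> and \<open>s = t\<close>.
\<close>

section \<open>Evaluation and renaming of terms\<close>

lemma teval_cong: "(\<And>x. x \<in> tvars t \<Longrightarrow> \<sigma> x = \<tau> x) \<Longrightarrow> teval \<sigma> t = teval \<tau> t"
  by (induction t) auto

lemma teval_upd [simp]: "x \<notin> tvars t \<Longrightarrow> teval (\<sigma>(x := a)) t = teval \<sigma> t"
  by (rule teval_cong) auto

fun trename :: "(nat \<Rightarrow> nat) \<Rightarrow> bt_term \<Rightarrow> bt_term" where
  "trename \<theta> (Var x) = Var (\<theta> x)"
| "trename \<theta> Const_e = Const_e"
| "trename \<theta> Const_0 = Const_0"
| "trename \<theta> Const_1 = Const_1"
| "trename \<theta> (s \<odot> t) = trename \<theta> s \<odot> trename \<theta> t"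

lemma teval_trename [simp]: "teval \<sigma> (trename \<theta> t) = teval (\<sigma> \<circ> \<theta>) t"
  by (induction t) auto

lemma tvars_trename [simp]: "tvars (trename \<theta> t) = \<theta> ` tvars t"
  by (induction t) auto

lemma finite_tvars [simp]: "finite (tvars t)"
  by (induction t) auto

subsection \<open>Word equations\<close>

text \<open>Each side consists of two blocks of equal length, so the equation splits in the middle.
  If \<open>s\<close> and \<open>t\<close> had different lengths, the longer one would need both
  letters at the position where the shorter one ends.\<close>

lemma conj_word_equation:
  fixes s t s' t' :: bitstring
  shows "s @ [False] @ s' @ s @ [True] @ s' = t @ [False] @ t' @ t @ [True] @ t'
    \<longleftrightarrow> s = t \<and> s' = t'" (is "?L \<longleftrightarrow> _")
proof
  assume L: ?L
  then have "length ((s @ [False] @ s') @ s @ [True] @ s')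
      = length ((t @ [False] @ t') @ t @ [True] @ t')"
    by simp
  then have len: "length (s @ [False] @ s') = length (t @ [False] @ t')"
    by simp
  have "(s @ [False] @ s') @ (s @ [True] @ s') = (t @ [False] @ t') @ (t @ [True] @ t')"
    using L by simp
  from this len have "s @ [False] @ s' = t @ [False] @ t' \<and> s @ [True] @ s' = t @ [True] @ t'"
    by (subst (asm) append_eq_append_conv) blast+
  then have F: "s @ False # s' = t @ False # t'" and T: "s @ True # s' = t @ True # t'"
    by simp_all
  from F T have "s = t"
  proof (induction s arbitrary: t)
    case Nil
    then show ?case by (cases t) auto
  next
    case (Cons a s)
    then show ?case by (cases t) auto
  qed
  with F show "s = t \<and> s' = t'" by simp
qed auto

text \<open>The only split of 01 into two nonempty words is 0 followed by 1, and swapping these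
  gives 10.\<close>

lemma commuting_factors_01:
  assumes "x @ y = [False, True]" and "y @ x = [False, True]"
  shows "x = [] \<or> y = []"
  using assms by (auto simp: append_eq_Cons_conv)

lemma commutes_with_01_and_10:
  assumes "z @ [False, True] = [False, True] @ z" and "z @ [True, False] = [True, False] @ z"
  shows "z = []"
  using assms by (cases z) auto

definition guarded_eq :: "bitstring \<Rightarrow> bitstring \<Rightarrow> bitstring \<Rightarrow> bool" where
  "guarded_eq x s t \<longleftrightarrow> (\<exists>x' p q r. x @ [False] = [False] @ x' \<and> s = p @ q \<and> t = p @ r \<and>
     q @ r @ x = x @ q @ r \<and> q @ r @ x' = x' @ q @ r)"

lemma guarded_eq_Nil: "guarded_eq [] s t"
  \<comment> \<open>For empty \<open>x\<close> no common prefix has to be split off: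
    \<open>[]\<close> serves for both \<open>x'\<close> and \<open>p\<close>, and then
    \<open>q\<close> is \<open>s\<close> and \<open>r\<close> is \<open>t\<close>.\<close>
  unfolding guarded_eq_def by (intro exI[of _ "[]"] exI[of _ s] exI[of _ t]) simp

lemma guarded_eq_01: "guarded_eq [False, True] s t \<longleftrightarrow> s = t"
proof
  assume "guarded_eq [False, True] s t"
  then obtain p q r where "s = p @ q" "t = p @ r"
    and "q @ r @ [False, True] = [False, True] @ q @ r"
    and "q @ r @ [True, False] = [True, False] @ q @ r"
    by (auto simp: guarded_eq_def)
  moreover from this have "q @ r = []"
    using commutes_with_01_and_10[of "q @ r"] by simp
  ultimately show "s = t" by simp
next
  assume "s = t"
  then show "guarded_eq [False, True] s t"
    unfolding guarded_eq_def
    \<comment> \<open>Here \<open>p\<close> is all of \<open>s\<close>, while \<open>q\<close> and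
      \<open>r\<close> are empty and so commute with everything.\<close>
    by (intro exI[of _ "[True, False]"] exI[of _ s] exI[of _ "[]"]) simp
qed

lemma disj_iff_guarded_eqs:
  "s = t \<or> s' = t' \<longleftrightarrow> (\<exists>x y. x @ y = [False, True] \<and> y @ x = [False, True] \<and>
     guarded_eq x s t \<and> guarded_eq y s' t')" (is "_ \<longleftrightarrow> ?R")
proof
  assume "s = t \<or> s' = t'"
  then show ?R
  proof
    assume "s = t"
    then show ?R
      by (intro exI[of _ "[False, True]"] exI[of _ "[]"]) (simp add: guarded_eq_Nil guarded_eq_01)
  next
    assume "s' = t'"
    then show ?R
      by (intro exI[of _ "[]"] exI[of _ "[False, True]"]) (simp add: guarded_eq_Nil guarded_eq_01)
  qed
next
  assume ?R
  then obtain x y where xy: "x @ y = [False, True]" "y @ x = [False, True]"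
    and g: "guarded_eq x s t" "guarded_eq y s' t'"
    by blast
  from commuting_factors_01[OF xy] xy g show "s = t \<or> s' = t'"
    by (auto simp: guarded_eq_01)
qed

text \<open>Either \<open>s\<close> properly extends \<open>t\<close>, or the two words differ first
  after a common part \<open>z\<close>. Naming the letters involved leaves only equations, so the
  negation disappears.\<close>

lemma not_prefix_iff:
  fixes s t :: bitstring
  shows "\<not> prefix s t \<longleftrightarrow> (\<exists>z u v.
    (s = t @ [False] @ u \<or> s = t @ [True] @ u) \<or>
    (s = z @ [False] @ u \<and> t = z @ [True] @ v \<or> s = z @ [True] @ u \<and> t = z @ [False] @ v))"
    (is "_ \<longleftrightarrow> (\<exists>z u v. ?R z u v)")
proof
  assume "\<not> prefix s t"
  then consider "strict_prefix t s" | "s \<parallel> t"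
    by (cases rule: prefix_cases[of s t]) auto
  then show "\<exists>z u v. ?R z u v"
  proof cases
    case 1
    then obtain c u where "s = t @ c # u"
      by (rule strict_prefixE')
    \<comment> \<open>Only the next letter and the rest \<open>u\<close> matter in this case;
      \<open>z\<close> and \<open>v\<close> get the default \<open>[]\<close>.\<close>
    then have "?R [] u []" by (cases c) simp_all
    then show ?thesis by blast
  next
    case 2
    from parallel_decomp[OF this] obtain z a u b v where "a \<noteq> b" "s = z @ a # u" "t = z @ b # v"
      by blast
    then have "?R z u v" by (cases a; cases b) simp_all
    then show ?thesis by blast
  qed
next
  assume "\<exists>z u v. ?R z u v"
  then obtain z u v where "?R z u v" by blast
  then show "\<not> prefix s t" by (elim disjE conjE) simp_all
qed

subsection \<open>Prenex predicates\<close>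

text \<open>The bound variables are de Bruijn levels: in \<open>prenex b n P\<close> the predicate \<open>P\<close> depends on the
  variables below \<open>n\<close> only, and the outermost quantifier binds \<open>n\<close>. The flag \<open>b\<close> says whether
  bounded universal quantifiers are allowed.\<close>

inductive prenex :: "bool \<Rightarrow> nat \<Rightarrow> ((nat \<Rightarrow> bitstring) \<Rightarrow> bool) \<Rightarrow> bool" for b where
  prenex_eq: "tvars s \<subseteq> {..<n} \<Longrightarrow> tvars t \<subseteq> {..<n} \<Longrightarrow>
    prenex b n (\<lambda>\<sigma>. teval \<sigma> s = teval \<sigma> t)"
| prenex_ex: "prenex b (Suc n) P \<Longrightarrow> prenex b n (\<lambda>\<sigma>. \<exists>a. P (\<sigma>(n := a)))"
| prenex_ball: "b \<Longrightarrow> prenex b (Suc n) P \<Longrightarrow> tvars t \<subseteq> {..<n} \<Longrightarrow>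
    prenex b n (\<lambda>\<sigma>. \<forall>a. prefix a (teval \<sigma> t) \<longrightarrow> P (\<sigma>(n := a)))"

lemma prenex_cong: "prenex b n P \<Longrightarrow> (\<And>\<sigma>. P \<sigma> \<longleftrightarrow> Q \<sigma>) \<Longrightarrow> prenex b n Q"
  by (rule back_subst[where P = "prenex b n" and a = P]) (auto intro: ext)

lemma prenex_depends:
  assumes "prenex b n P" and "\<And>i. i < n \<Longrightarrow> \<sigma> i = \<tau> i"
  shows "P \<sigma> \<longleftrightarrow> P \<tau>"
  using assms
proof (induction arbitrary: \<sigma> \<tau>)
  case (prenex_eq s n t)
  then have "teval \<sigma> s = teval \<tau> s" "teval \<sigma> t = teval \<tau> t"
    by (auto intro!: teval_cong)
  then show ?case by simp
next
  case (prenex_ex n P)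
  have "P (\<sigma>(n := a)) = P (\<tau>(n := a))" for a
    by (rule prenex_ex.IH) (use prenex_ex.prems in \<open>auto simp: less_Suc_eq\<close>)
  then show ?case by simp
next
  case (prenex_ball n P t)
  have "P (\<sigma>(n := a)) = P (\<tau>(n := a))" for a
    by (rule prenex_ball.IH) (use prenex_ball.prems in \<open>auto simp: less_Suc_eq\<close>)
  moreover have "teval \<sigma> t = teval \<tau> t"
    using prenex_ball by (auto intro!: teval_cong)
  ultimately show ?case by simp
qed

text \<open>Levels serve directly as variable names. A bound mentions only levels below the one
  being quantified, which makes the quantifier admissible.\<close>

lemma prenex_imp_formula:
  assumes "prenex b n P"
  shows "\<exists>Qs s t. (\<forall>Q \<in> set Qs. admissible Q) \<and> (\<forall>\<sigma>. P \<sigma> \<longleftrightarrow> sat \<sigma> (foldr quantify Qs (s \<doteq> t))) \<and>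
    (\<not> b \<longrightarrow> (\<forall>Q \<in> set Qs. \<exists>v. Q = QEx v))"
  using assms
proof induction
  case (prenex_eq s n t)
  show ?case by (intro exI[of _ "[]"] exI[of _ s] exI[of _ t]) simp
next
  case (prenex_ex n P)
  then obtain Qs s t where "(\<forall>Q \<in> set Qs. admissible Q) \<and>
      (\<forall>\<sigma>. P \<sigma> \<longleftrightarrow> sat \<sigma> (foldr quantify Qs (s \<doteq> t))) \<and> (\<not> b \<longrightarrow> (\<forall>Q \<in> set Qs. \<exists>v. Q = QEx v))"
    by blast
  then show ?case by (intro exI[of _ "QEx n # Qs"] exI[of _ s] exI[of _ t]) simp
next
  case (prenex_ball n P u)
  then obtain Qs s t where "(\<forall>Q \<in> set Qs. admissible Q) \<and>
      (\<forall>\<sigma>. P \<sigma> \<longleftrightarrow> sat \<sigma> (foldr quantify Qs (s \<doteq> t)))"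
    by blast
  moreover have "n \<notin> tvars u" using prenex_ball by auto
  ultimately show ?case using \<open>b\<close>
    by (intro exI[of _ "QBAll n u # Qs"] exI[of _ s] exI[of _ t]) simp
qed

text \<open>The empty word satisfies every bound, so a bounded universal quantifier can be moved across
  a conjunction as well.\<close>

lemma connective_quantifiers:
  assumes "con = (\<and>) \<or> con = (\<or>)"
  shows "con (\<exists>a. P a) q \<longleftrightarrow> (\<exists>a. con (P a) q)"
    and "con q (\<exists>a. P a) \<longleftrightarrow> (\<exists>a. con q (P a))"
    and "con (\<forall>a. prefix a w \<longrightarrow> P a) q \<longleftrightarrow> (\<forall>a. prefix a w \<longrightarrow> con (P a) q)"
    and "con q (\<forall>a. prefix a w \<longrightarrow> P a) \<longleftrightarrow> (\<forall>a. prefix a w \<longrightarrow> con q (P a))"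
  using assms by (auto intro: Nil_prefix)

text \<open>First half of the prenexing: the quantifiers of the second operand are pulled out over
  an equation, until \<open>base\<close> merges two equations. Only \<open>base\<close> is specific
  to the connective.\<close>

lemma prenex_connective_eq:
  assumes con: "con = (\<and>) \<or> con = (\<or>)"
    and base: "\<And>n s t s' t'. \<lbrakk>tvars s \<subseteq> {..<n}; tvars t \<subseteq> {..<n}; tvars s' \<subseteq> {..<n}; tvars t' \<subseteq> {..<n}\<rbrakk>
      \<Longrightarrow> prenex b n (\<lambda>\<sigma>. con (teval \<sigma> s = teval \<sigma> t) (teval \<sigma> s' = teval \<sigma> t'))"
    and Q: "prenex b n Q" and st: "tvars s \<subseteq> {..<n}" "tvars t \<subseteq> {..<n}"
  shows "prenex b n (\<lambda>\<sigma>. con (teval \<sigma> s = teval \<sigma> t) (Q \<sigma>))"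
  using Q st
proof induction
  case (prenex_eq s' n t')
  then show ?case by (intro base)
next
  case (prenex_ex n Q)
  from prenex_ex.prems have n: "n \<notin> tvars s" "n \<notin> tvars t" by auto
  have "prenex b (Suc n) (\<lambda>\<sigma>. con (teval \<sigma> s = teval \<sigma> t) (Q \<sigma>))"
    using prenex_ex.prems by (intro prenex_ex.IH) auto
  from prenex.prenex_ex[OF this] show ?case
    by (rule prenex_cong) (simp add: connective_quantifiers[OF con] n)
next
  case (prenex_ball n Q u)
  from prenex_ball.prems have n: "n \<notin> tvars s" "n \<notin> tvars t" by auto
  have "prenex b (Suc n) (\<lambda>\<sigma>. con (teval \<sigma> s = teval \<sigma> t) (Q \<sigma>))"
    using prenex_ball.prems by (intro prenex_ball.IH) auto
  from prenex.prenex_ball[OF \<open>b\<close> this \<open>tvars u \<subseteq> {..<n}\<close>] show ?case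
    by (rule prenex_cong) (simp add: connective_quantifiers[OF con] n)
qed

text \<open>Second half: the quantifiers of \<open>P\<close> go in front of those of
  \<open>Q\<close>. They raise the level at which \<open>Q\<close> is placed, so \<open>Q\<close>
  has to be prenex at every level from \<open>n\<close> on; by \<open>prenex_depends\<close> it
  ignores the new variables.\<close>

lemma prenex_connective:
  assumes con: "con = (\<and>) \<or> con = (\<or>)"
    and base: "\<And>n s t s' t'. \<lbrakk>tvars s \<subseteq> {..<n}; tvars t \<subseteq> {..<n}; tvars s' \<subseteq> {..<n}; tvars t' \<subseteq> {..<n}\<rbrakk>
      \<Longrightarrow> prenex b n (\<lambda>\<sigma>. con (teval \<sigma> s = teval \<sigma> t) (teval \<sigma> s' = teval \<sigma> t'))"
    and P: "prenex b n P" and Q: "\<And>m. n \<le> m \<Longrightarrow> prenex b m Q"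
  shows "prenex b n (\<lambda>\<sigma>. con (P \<sigma>) (Q \<sigma>))"
  using P Q
proof induction
  case (prenex_eq s n t)
  then show ?case by (intro prenex_connective_eq[OF con base]) auto
next
  case (prenex_ex n P)
  have Qn: "Q (\<sigma>(n := a)) = Q \<sigma>" for \<sigma> a
    by (rule prenex_depends[OF prenex_ex.prems[OF order_refl]]) simp
  have "prenex b (Suc n) (\<lambda>\<sigma>. con (P \<sigma>) (Q \<sigma>))"
    using prenex_ex.prems by (intro prenex_ex.IH) auto
  from prenex.prenex_ex[OF this] show ?case
    by (rule prenex_cong) (simp add: connective_quantifiers[OF con] Qn)
next
  case (prenex_ball n P u)
  have Qn: "Q (\<sigma>(n := a)) = Q \<sigma>" for \<sigma> a
    by (rule prenex_depends[OF prenex_ball.prems[OF order_refl]]) simp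
  have "prenex b (Suc n) (\<lambda>\<sigma>. con (P \<sigma>) (Q \<sigma>))"
    using prenex_ball.prems by (intro prenex_ball.IH) auto
  from prenex.prenex_ball[OF \<open>b\<close> this \<open>tvars u \<subseteq> {..<n}\<close>] show ?case
    by (rule prenex_cong) (simp add: connective_quantifiers[OF con] Qn)
qed

subsection \<open>Formulas with a prenex form\<close>

text \<open>Closing under all renamings \<open>\<theta>\<close> of the variables below \<open>k\<close> lets a quantified variable be
  replaced by the level prescribed by \<^const>\<open>prenex\<close>.\<close>

definition has_prenex :: "bool \<Rightarrow> nat \<Rightarrow> bt_formula \<Rightarrow> bool" where
  "has_prenex b k \<phi> \<longleftrightarrow>
     (\<forall>\<theta> n. \<theta> ` {..<k} \<subseteq> {..<n} \<longrightarrow> prenex b n (\<lambda>\<sigma>. sat (\<sigma> \<circ> \<theta>) \<phi>))"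

lemma has_prenexD: "has_prenex b k \<phi> \<Longrightarrow> prenex b k (\<lambda>\<sigma>. sat \<sigma> \<phi>)"
  unfolding has_prenex_def by (drule spec[of _ id], drule spec[of _ k]) simp

lemma has_prenex_depends:
  "has_prenex b k \<phi> \<Longrightarrow> (\<And>i. i < k \<Longrightarrow> \<sigma> i = \<tau> i) \<Longrightarrow> sat \<sigma> \<phi> \<longleftrightarrow> sat \<tau> \<phi>"
  using prenex_depends[OF has_prenexD] .

lemma has_prenex_mono: "has_prenex b k \<phi> \<Longrightarrow> k \<le> l \<Longrightarrow> has_prenex b l \<phi>"
  unfolding has_prenex_def by (meson image_mono lessThan_subset_iff order_trans)

lemma has_prenex_cong: "has_prenex b k \<phi> \<Longrightarrow> D_equivalent \<phi> \<psi> \<Longrightarrow> has_prenex b k \<psi>"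
  unfolding has_prenex_def D_equivalent_def by simp

section \<open>Equations and quantifiers\<close>

lemma has_prenex_Eq:
  assumes "tvars s \<subseteq> {..<k}" and "tvars t \<subseteq> {..<k}"
  shows "has_prenex b k (s \<doteq> t)"
  unfolding has_prenex_def
proof (intro allI impI)
  fix \<theta> :: "nat \<Rightarrow> nat" and n assume "\<theta> ` {..<k} \<subseteq> {..<n}"
  with assms have "prenex b n (\<lambda>\<sigma>. teval \<sigma> (trename \<theta> s) = teval \<sigma> (trename \<theta> t))"
    by (intro prenex_eq) auto
  then show "prenex b n (\<lambda>\<sigma>. sat (\<sigma> \<circ> \<theta>) (s \<doteq> t))" by simp
qed

text \<open>Sending \<open>x\<close> to the new level \<open>n\<close> and updating there has the
  effect of updating \<open>x\<close> itself, because the other relevant variables are sent to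
  levels below \<open>n\<close>.\<close>

lemma upd_comp_agree:
  fixes n k l x :: nat
  assumes "\<theta> ` {..<k} \<subseteq> {..<n}" and "{..<l} \<subseteq> insert x {..<k}" and "i < l"
  shows "(\<sigma>(n := a) \<circ> \<theta>(x := n)) i = ((\<sigma> \<circ> \<theta>)(x := a)) i"
proof (cases "i = x")
  case False
  with assms have "\<theta> i < n" by auto
  with False show ?thesis by auto
qed simp

text \<open>Two bounds are needed for two uses: \<open>l = k\<close> for a quantifier of the given
  formula, and \<open>l = Suc k\<close> with \<open>x = k\<close> for a freshly introduced
  variable.\<close>

lemma has_prenex_Ex:
  assumes \<phi>: "has_prenex b l \<phi>" and lk: "{..<l} \<subseteq> insert x {..<k}"
  shows "has_prenex b k (Ex x \<phi>)"
  unfolding has_prenex_def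
proof (intro allI impI)
  fix \<theta> :: "nat \<Rightarrow> nat" and n assume \<theta>: "\<theta> ` {..<k} \<subseteq> {..<n}"
  have agree: "sat (\<sigma>(n := a) \<circ> \<theta>(x := n)) \<phi> \<longleftrightarrow> sat ((\<sigma> \<circ> \<theta>)(x := a)) \<phi>" for \<sigma> a
    by (rule has_prenex_depends[OF \<phi> upd_comp_agree[OF \<theta> lk]])
  have "\<theta>(x := n) ` {..<l} \<subseteq> {..<Suc n}"
    using \<theta> lk by (fastforce simp: less_Suc_eq)
  with \<phi> have "prenex b (Suc n) (\<lambda>\<sigma>. sat (\<sigma> \<circ> \<theta>(x := n)) \<phi>)"
    by (simp add: has_prenex_def)
  from prenex_ex[OF this] show "prenex b n (\<lambda>\<sigma>. sat (\<sigma> \<circ> \<theta>) (Ex x \<phi>))"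
    by (rule prenex_cong) (simp add: agree)
qed

lemma has_prenex_Ex_fresh: "has_prenex b (Suc k) \<phi> \<Longrightarrow> has_prenex b k (Ex k \<phi>)"
  by (rule has_prenex_Ex) auto

lemma has_prenex_BAll:
  assumes \<phi>: "has_prenex True k \<phi>" and t: "tvars t \<subseteq> {..<k}" "x \<notin> tvars t"
  shows "has_prenex True k (BAll x t \<phi>)"
  unfolding has_prenex_def
proof (intro allI impI)
  fix \<theta> :: "nat \<Rightarrow> nat" and n assume \<theta>: "\<theta> ` {..<k} \<subseteq> {..<n}"
  have kk: "{..<k} \<subseteq> insert x {..<k}" by auto
  have agree: "sat (\<sigma>(n := a) \<circ> \<theta>(x := n)) \<phi> \<longleftrightarrow> sat ((\<sigma> \<circ> \<theta>)(x := a)) \<phi>" for \<sigma> a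
    by (rule has_prenex_depends[OF \<phi> upd_comp_agree[OF \<theta> kk]])
  have "\<theta>(x := n) ` {..<k} \<subseteq> {..<Suc n}"
    using \<theta> by (fastforce simp: less_Suc_eq)
  with \<phi> have "prenex True (Suc n) (\<lambda>\<sigma>. sat (\<sigma> \<circ> \<theta>(x := n)) \<phi>)"
    by (simp add: has_prenex_def)
  moreover have "tvars (trename \<theta> t) \<subseteq> {..<n}" using t \<theta> by auto
  ultimately have "prenex True n (\<lambda>\<sigma>. \<forall>a. prefix a (teval \<sigma> (trename \<theta> t)) \<longrightarrow>
      sat (\<sigma>(n := a) \<circ> \<theta>(x := n)) \<phi>)"
    by (intro prenex_ball TrueI)
  then show "prenex True n (\<lambda>\<sigma>. sat (\<sigma> \<circ> \<theta>) (BAll x t \<phi>))"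
    by (rule prenex_cong) (simp add: agree t(2))
qed

section \<open>Conjunction and disjunction\<close>

lemma has_prenex_connective:
  assumes con: "con = (\<and>) \<or> con = (\<or>)"
    and base: "\<And>n s t s' t'. \<lbrakk>tvars s \<subseteq> {..<n}; tvars t \<subseteq> {..<n}; tvars s' \<subseteq> {..<n}; tvars t' \<subseteq> {..<n}\<rbrakk>
      \<Longrightarrow> prenex b n (\<lambda>\<sigma>. con (teval \<sigma> s = teval \<sigma> t) (teval \<sigma> s' = teval \<sigma> t'))"
    and \<phi>: "has_prenex b k \<phi>" and \<psi>: "has_prenex b k \<psi>"
    and \<chi>: "\<And>\<sigma>. sat \<sigma> \<chi> \<longleftrightarrow> con (sat \<sigma> \<phi>) (sat \<sigma> \<psi>)"
  shows "has_prenex b k \<chi>"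
  unfolding has_prenex_def \<chi>
proof (intro allI impI prenex_connective[OF con base])
  fix \<theta> :: "nat \<Rightarrow> nat" and n assume \<theta>: "\<theta> ` {..<k} \<subseteq> {..<n}"
  then show "prenex b n (\<lambda>\<sigma>. sat (\<sigma> \<circ> \<theta>) \<phi>)"
    using \<phi> by (simp add: has_prenex_def)
  fix m assume "n \<le> m"
  with \<theta> have "\<theta> ` {..<k} \<subseteq> {..<m}" by auto
  then show "prenex b m (\<lambda>\<sigma>. sat (\<sigma> \<circ> \<theta>) \<psi>)"
    using \<psi> by (simp add: has_prenex_def)
qed auto

lemma has_prenex_And:
  assumes "has_prenex b k \<phi>" and "has_prenex b k \<psi>"
  shows "has_prenex b k (And \<phi> \<psi>)"
proof (rule has_prenex_connective[where con = "(\<and>)", OF _ _ assms])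
  fix n s t s' t'
  assume "tvars s \<subseteq> {..<n}" "tvars t \<subseteq> {..<n}" "tvars s' \<subseteq> {..<n}" "tvars t' \<subseteq> {..<n}"
  then have "prenex b n (\<lambda>\<sigma>. teval \<sigma> (s \<odot> Const_0 \<odot> s' \<odot> s \<odot> Const_1 \<odot> s')
      = teval \<sigma> (t \<odot> Const_0 \<odot> t' \<odot> t \<odot> Const_1 \<odot> t'))"
    by (intro prenex_eq) auto
  then show "prenex b n (\<lambda>\<sigma>. teval \<sigma> s = teval \<sigma> t \<and> teval \<sigma> s' = teval \<sigma> t')"
    by (simp only: teval.simps conj_word_equation)
qed auto

lemma has_prenex_guarded_eq:
  assumes "tvars x \<subseteq> {..<k}" and "tvars s \<subseteq> {..<k}" and "tvars t \<subseteq> {..<k}"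
  obtains \<chi> where "has_prenex b k \<chi>"
    and "\<And>\<sigma>. sat \<sigma> \<chi> \<longleftrightarrow> guarded_eq (teval \<sigma> x) (teval \<sigma> s) (teval \<sigma> t)"
proof -
  let ?k1 = "Suc k" let ?k2 = "Suc ?k1" let ?k3 = "Suc ?k2"
  let ?x' = "Var k" and ?p = "Var ?k1" and ?q = "Var ?k2" and ?r = "Var ?k3"
  have fresh: "i \<notin> tvars x" "i \<notin> tvars s" "i \<notin> tvars t" if "k \<le> i" for i
    using assms that by auto
  have bounds: "tvars x \<subseteq> {..<Suc ?k3}" "tvars s \<subseteq> {..<Suc ?k3}" "tvars t \<subseteq> {..<Suc ?k3}"
    using assms by fastforce+
  define \<chi> where "\<chi> = Ex k (Ex ?k1 (Ex ?k2 (Ex ?k3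
    (And (x \<odot> Const_0 \<doteq> Const_0 \<odot> ?x') (And (s \<doteq> ?p \<odot> ?q) (And (t \<doteq> ?p \<odot> ?r)
    (And (?q \<odot> ?r \<odot> x \<doteq> x \<odot> ?q \<odot> ?r) (?q \<odot> ?r \<odot> ?x' \<doteq> ?x' \<odot> ?q \<odot> ?r))))))))"
  have "has_prenex b k \<chi>"
    unfolding \<chi>_def
    by (intro has_prenex_Ex_fresh has_prenex_And has_prenex_Eq) (simp_all add: bounds)
  moreover have "sat \<sigma> \<chi> \<longleftrightarrow> guarded_eq (teval \<sigma> x) (teval \<sigma> s) (teval \<sigma> t)" for \<sigma>
    by (simp add: \<chi>_def guarded_eq_def fresh)
  ultimately show thesis by (rule that)
qed

text \<open>Unlike conjunction, disjunction is not turned into a single equation directly: its base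
  case is expressed with existential quantifiers and conjunctions, so it builds on
  \<open>has_prenex_And\<close>.\<close>

lemma prenex_disj_eq:
  assumes "tvars s \<subseteq> {..<n}" and "tvars t \<subseteq> {..<n}" and "tvars s' \<subseteq> {..<n}" and "tvars t' \<subseteq> {..<n}"
  shows "prenex b n (\<lambda>\<sigma>. teval \<sigma> s = teval \<sigma> t \<or> teval \<sigma> s' = teval \<sigma> t')"
proof -
  let ?x = "Var n" and ?y = "Var (Suc n)" and ?m = "Suc (Suc n)"
  have fresh: "i \<notin> tvars s" "i \<notin> tvars t" "i \<notin> tvars s'" "i \<notin> tvars t'" if "n \<le> i" for i
    using assms that by auto
  have bounds: "tvars s \<subseteq> {..<?m}" "tvars t \<subseteq> {..<?m}" "tvars s' \<subseteq> {..<?m}" "tvars t' \<subseteq> {..<?m}"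
    using assms by fastforce+
  obtain \<chi> where \<chi>: "has_prenex b ?m \<chi>"
    "\<And>\<sigma>. sat \<sigma> \<chi> \<longleftrightarrow> guarded_eq (\<sigma> n) (teval \<sigma> s) (teval \<sigma> t)"
    using has_prenex_guarded_eq[of ?x ?m s t b] bounds by auto
  obtain \<chi>' where \<chi>': "has_prenex b ?m \<chi>'"
    "\<And>\<sigma>. sat \<sigma> \<chi>' \<longleftrightarrow> guarded_eq (\<sigma> (Suc n)) (teval \<sigma> s') (teval \<sigma> t')"
    using has_prenex_guarded_eq[of ?y ?m s' t' b] bounds by auto
  have "has_prenex b n (Ex n (Ex (Suc n) (And (?x \<odot> ?y \<doteq> Const_0 \<odot> Const_1)
    (And (?y \<odot> ?x \<doteq> Const_0 \<odot> Const_1) (And \<chi> \<chi>')))))"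
    by (intro has_prenex_Ex_fresh has_prenex_And has_prenex_Eq \<chi>(1) \<chi>'(1)) auto
  from has_prenexD[OF this] show ?thesis
    by (rule prenex_cong) (simp add: \<chi>(2) \<chi>'(2) disj_iff_guarded_eqs fresh)
qed

lemma has_prenex_Or:
  assumes "has_prenex b k \<phi>" and "has_prenex b k \<psi>"
  shows "has_prenex b k (Or \<phi> \<psi>)"
  by (rule has_prenex_connective[where con = "(\<or>)", OF _ _ assms]) (auto intro: prenex_disj_eq)

section \<open>The prefix relation and negated atoms\<close>

lemma has_prenex_Pre:
  assumes "tvars s \<subseteq> {..<k}" and "tvars t \<subseteq> {..<k}"
  shows "has_prenex b k (s \<preceq>\<^sub>B t)"
proof (rule has_prenex_cong)
  show "has_prenex b k (Ex k (t \<doteq> s \<odot> Var k))"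
    using assms by (intro has_prenex_Ex_fresh has_prenex_Eq) auto
  have "k \<notin> tvars s" "k \<notin> tvars t"
    using assms by auto
  then show "D_equivalent (Ex k (t \<doteq> s \<odot> Var k)) (s \<preceq>\<^sub>B t)"
    by (simp add: D_equivalent_def prefix_def)
qed

lemma has_prenex_Neg_Pre:
  assumes "tvars s \<subseteq> {..<k}" and "tvars t \<subseteq> {..<k}"
  shows "has_prenex b k (Neg (s \<preceq>\<^sub>B t))"
proof -
  let ?k1 = "Suc k" let ?k2 = "Suc ?k1"
  let ?z = "Var k" and ?u = "Var ?k1" and ?v = "Var ?k2"
  have fresh: "i \<notin> tvars s" "i \<notin> tvars t" if "k \<le> i" for i
    using assms that by auto
  have bounds: "tvars s \<subseteq> {..<Suc ?k2}" "tvars t \<subseteq> {..<Suc ?k2}"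
    using assms by fastforce+
  have "has_prenex b k (Ex k (Ex ?k1 (Ex ?k2
    (Or (Or (s \<doteq> t \<odot> Const_0 \<odot> ?u) (s \<doteq> t \<odot> Const_1 \<odot> ?u))
      (Or (And (s \<doteq> ?z \<odot> Const_0 \<odot> ?u) (t \<doteq> ?z \<odot> Const_1 \<odot> ?v))
          (And (s \<doteq> ?z \<odot> Const_1 \<odot> ?u) (t \<doteq> ?z \<odot> Const_0 \<odot> ?v)))))))" (is "has_prenex b k ?\<chi>")
    by (intro has_prenex_Ex_fresh has_prenex_And has_prenex_Or has_prenex_Eq)
      (simp_all add: bounds)
  moreover have "D_equivalent ?\<chi> (Neg (s \<preceq>\<^sub>B t))"
    by (simp add: D_equivalent_def not_prefix_iff fresh)
  ultimately show ?thesis by (rule has_prenex_cong)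
qed

text \<open>Two words are equal exactly when each is a prefix of the other, which reduces inequality
  to the negated prefix relation.\<close>

lemma has_prenex_Neg_Eq:
  assumes "tvars s \<subseteq> {..<k}" and "tvars t \<subseteq> {..<k}"
  shows "has_prenex b k (Neg (s \<doteq> t))"
proof (rule has_prenex_cong)
  show "has_prenex b k (Or (Neg (s \<preceq>\<^sub>B t)) (Neg (t \<preceq>\<^sub>B s)))"
    using assms by (intro has_prenex_Or has_prenex_Neg_Pre)
  show "D_equivalent (Or (Neg (s \<preceq>\<^sub>B t)) (Neg (t \<preceq>\<^sub>B s))) (Neg (s \<doteq> t))"
    by (auto simp: D_equivalent_def dest: prefix_order.antisym)
qed

section \<open>Induction over \<Sigma>-formulas\<close>

lemma tvars_bound: obtains k where "tvars s \<subseteq> {..<k}" and "tvars t \<subseteq> {..<k}"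
  using finite_nat_set_iff_bounded[of "tvars s \<union> tvars t"] by auto

lemma Sigma_formula_has_prenex:
  assumes "Sigma_formula \<phi>" and "b \<or> All_free \<phi>"
  shows "\<exists>k. has_prenex b k \<phi>"
  using assms
proof induction
  case (1 s t)
  then show ?case using tvars_bound[of s t] has_prenex_Pre by metis
next
  case (2 s t)
  then show ?case using tvars_bound[of s t] has_prenex_Neg_Pre by metis
next
  case (3 s t)
  then show ?case using tvars_bound[of s t] has_prenex_Eq by metis
next
  case (4 s t)
  then show ?case using tvars_bound[of s t] has_prenex_Neg_Eq by metis
next
  case (5 \<phi> \<psi>)
  then obtain k l where "has_prenex b k \<phi>" "has_prenex b l \<psi>" by auto
  then have "has_prenex b (max k l) (And \<phi> \<psi>)"
    by (intro has_prenex_And) (auto elim: has_prenex_mono)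
  then show ?case ..
next
  case (6 \<phi> \<psi>)
  then obtain k l where "has_prenex b k \<phi>" "has_prenex b l \<psi>" by auto
  then have "has_prenex b (max k l) (Or \<phi> \<psi>)"
    by (intro has_prenex_Or) (auto elim: has_prenex_mono)
  then show ?case ..
next
  case (7 \<phi> x t)
  then obtain k where k: "has_prenex b k \<phi>" by auto
  obtain l where l: "tvars (Var x) \<subseteq> {..<l}" "tvars t \<subseteq> {..<l}" by (rule tvars_bound)
  \<comment> \<open>A bounded existential quantifier is treated as an unbounded one over a
    conjunction, so it also yields only unbounded existential quantifiers when \<open>b\<close> is
    false.\<close>
  have "has_prenex b (max k l) (And (Var x \<preceq>\<^sub>B t) \<phi>)"
    using has_prenex_mono[OF has_prenex_Pre[OF l]] has_prenex_mono[OF k]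
    by (intro has_prenex_And) auto
  then have "has_prenex b (max k l) (BEx x t \<phi>)"
    by (rule has_prenex_Ex) auto
  then show ?case ..
next
  case (8 \<phi> x t)
  \<comment> \<open>The formula contains \<open>All\<close> and hence is not
    \<open>All_free\<close>, so the flag must permit universal quantifiers.\<close>
  then have b by auto
  with 8 obtain k where k: "has_prenex True k \<phi>" by auto
  obtain l where l: "tvars t \<subseteq> {..<l}" by (rule tvars_bound)
  have "has_prenex True (max k l) (BAll x t \<phi>)"
    using has_prenex_mono[OF k] l 8 by (intro has_prenex_BAll) auto
  with \<open>b\<close> show ?case by auto
next
  case (9 \<phi> x)
  then obtain k where "has_prenex b k \<phi>" by auto
  then have "has_prenex b k (Ex x \<phi>)"
    by (rule has_prenex_Ex) auto
  then show ?case ..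
qed

theorem theorem8:
  fixes \<phi> :: bt_formula
  assumes "Sigma_formula \<phi>"
  shows "\<exists>(Qs :: quantifier list) (s :: bt_term) (t :: bt_term).
           (\<forall>Q \<in> set Qs. admissible Q) \<and>
           D_equivalent \<phi> (foldr quantify Qs (s \<doteq> t)) \<and>
           (purely_existential \<phi> \<longrightarrow> (\<forall>Q \<in> set Qs. \<exists>v. Q = QEx v))"
proof -
  \<comment> \<open>Bounded universal quantifiers are permitted exactly when the formula is not
    purely existential, so one run covers both claims.\<close>
  define b where "b \<longleftrightarrow> \<not> purely_existential \<phi>"
  have "b \<or> All_free \<phi>"
    by (auto simp: b_def purely_existential_def)
  with Sigma_formula_has_prenex[OF assms] obtain k where "has_prenex b k \<phi>" by blast
  from prenex_imp_formula[OF has_prenexD[OF this]] show ?thesis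
    by (simp add: D_equivalent_def b_def)
qed

end
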